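(* Let $n\ge 3$, let $W_n = K_1\vee C_n$ be the wheel graph and let $\sigma$ be a signature of $W_n$. If $n$ is even, or if $n$ is odd and $(W_n,\sigma)$ is not switching equivalent to $-W_n$, then $l(W_n,\sigma) = p^-(W_n,\sigma) = p^-_\triangle(W_n,\sigma)$.
   Context: All graphs are finite, simple and undirected. A signed graph $\Sigma=(G,\sigma)$ is a graph $G$ with a signature $\sigma:E(G)\to\{+1,-1\}$. The sign of a cycle is the product of the signs of its edges; $\Sigma$ is balanced if all its cycles are positive. The frustration index $l(\Sigma)$ is the minimum number of edges whose deletion makes $\Sigma$ balanced. $p^-(\Sigma)$ (respectively $p^-_\triangle(\Sigma)$) is the maximum number of pairwise edge-disjoint negative cycles (respectively negative triangles) in $\Sigma$. $-G$ is $G$ with all edges signed $-1$. Switching $\Sigma$ at a vertex subset $X$ negates the signs of all edges with exactly one endpoint in $X$; two signed graphs on $G$ are switching equivalent if one is obtained from the other by switching. $C_n$ is the cycle on $n$ vertices and $\vee$ denotes the join of vertex-disjoint graphs. *)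

theory Defs
  imports Main
begin

record 'a graph =
  verts :: "'a set"
  edges :: "'a set set"

definition simple_graph :: "'a graph \<Rightarrow> bool" where
  "simple_graph G \<longleftrightarrow> finite (verts G) \<and> (\<forall>e\<in>edges G. e \<subseteq> verts G \<and> card e = 2)"

definition delete_edges :: "'a graph \<Rightarrow> 'a set set \<Rightarrow> 'a graph" where
  "delete_edges G F = G\<lparr>edges := edges G - F\<rparr>"

definition complete_graph :: "'a set \<Rightarrow> 'a graph" where
  "complete_graph S = \<lparr>verts = S, edges = {{u, v} |u v. u \<in> S \<and> v \<in> S \<and> u \<noteq> v}\<rparr>"

text \<open>Meaningful for \<open>n \<ge> 3\<close> only.\<close>
definition cycle_graph :: "nat \<Rightarrow> nat graph" where
  "cycle_graph n = \<lparr>verts = {..<n}, edges = {{i, Suc i mod n} |i. i < n}\<rparr>"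

text \<open>The join of two graphs; intended for graphs with disjoint vertex sets.\<close>
definition graph_join :: "'a graph \<Rightarrow> 'a graph \<Rightarrow> 'a graph" where
  "graph_join G H =
     \<lparr>verts = verts G \<union> verts H,
      edges = edges G \<union> edges H \<union> {{u, v} |u v. u \<in> verts G \<and> v \<in> verts H}\<rparr>"

text \<open>The rim vertices are \<open>0, \<dots>, n - 1\<close>, and the hub is \<open>n\<close>.\<close>
definition wheel :: "nat \<Rightarrow> nat graph" where
  "wheel n = graph_join (complete_graph {n}) (cycle_graph n)"

lemma simple_graph_wheel:
  assumes "n \<ge> 3"
  shows "simple_graph (wheel n)"
proof -
  have "i \<noteq> Suc i mod n" if "i < n" for i
    using that assms by (cases "Suc i = n") auto
  moreover have "Suc i mod n < Suc n" for i
    using assms by (meson less_SucI mod_less_divisor less_le_trans zero_less_numeral)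
  ultimately show ?thesis
    using assms
    by (auto simp: simple_graph_def wheel_def graph_join_def complete_graph_def
        cycle_graph_def card_2_iff)
qed

text \<open>A cycle is identified with its edge set, which determines it as a subgraph.\<close>
definition cycle_edges :: "'a list \<Rightarrow> 'a set set" where
  "cycle_edges vs = {{vs ! i, vs ! (Suc i mod length vs)} |i. i < length vs}"

definition cycles :: "'a graph \<Rightarrow> 'a set set set" where
  "cycles G = {cycle_edges vs |vs.
     length vs \<ge> 3 \<and> distinct vs \<and> set vs \<subseteq> verts G \<and> cycle_edges vs \<subseteq> edges G}"

definition triangles :: "'a graph \<Rightarrow> 'a set set set" where
  "triangles G = {C \<in> cycles G. card C = 3}"

text \<open>A signed graph is given by \<open>G\<close> and \<open>\<sigma>\<close> separately; the values of \<open>\<sigma>\<close> outside \<open>edges G\<close> are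
  irrelevant throughout.\<close>
definition signature :: "'a graph \<Rightarrow> ('a set \<Rightarrow> int) \<Rightarrow> bool" where
  "signature G \<sigma> \<longleftrightarrow> (\<forall>e\<in>edges G. \<sigma> e \<in> {1, -1})"

definition cycle_sign :: "('a set \<Rightarrow> int) \<Rightarrow> 'a set set \<Rightarrow> int" where
  "cycle_sign \<sigma> C = (\<Prod>e\<in>C. \<sigma> e)"

definition balanced :: "'a graph \<Rightarrow> ('a set \<Rightarrow> int) \<Rightarrow> bool" where
  "balanced G \<sigma> \<longleftrightarrow> (\<forall>C\<in>cycles G. cycle_sign \<sigma> C = 1)"

definition frustration_index :: "'a graph \<Rightarrow> ('a set \<Rightarrow> int) \<Rightarrow> nat" where
  "frustration_index G \<sigma> =
     Min {card F |F. F \<subseteq> edges G \<and> balanced (delete_edges G F) \<sigma>}"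

definition neg_cycle_packing :: "'a graph \<Rightarrow> ('a set \<Rightarrow> int) \<Rightarrow> nat" where
  "neg_cycle_packing G \<sigma> =
     Max {card P |P. P \<subseteq> {C \<in> cycles G. cycle_sign \<sigma> C = -1} \<and> pairwise disjnt P}"

definition neg_triangle_packing :: "'a graph \<Rightarrow> ('a set \<Rightarrow> int) \<Rightarrow> nat" where
  "neg_triangle_packing G \<sigma> =
     Max {card P |P. P \<subseteq> {C \<in> triangles G. cycle_sign \<sigma> C = -1} \<and> pairwise disjnt P}"

definition switch :: "'a set \<Rightarrow> ('a set \<Rightarrow> int) \<Rightarrow> 'a set \<Rightarrow> int" where
  "switch X \<sigma> e = (if card (e \<inter> X) = 1 then - \<sigma> e else \<sigma> e)"

definition switching_equivalent ::
  "'a graph \<Rightarrow> ('a set \<Rightarrow> int) \<Rightarrow> ('a set \<Rightarrow> int) \<Rightarrow> bool" where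
  "switching_equivalent G \<sigma> \<tau> \<longleftrightarrow>
     (\<exists>X\<subseteq>verts G. \<forall>e\<in>edges G. \<tau> e = switch X \<sigma> e)"

definition all_negative :: "'a set \<Rightarrow> int" where
  "all_negative e = -1"

end

(* Let T_i be the triangle on the hub and the rim vertices i, i + 1, and let N be the set of those i
   for which T_i is negative. Walking round the rim, choose greedily those i in N whose predecessor
   was not chosen; this can be done consistently unless N is everything and n is odd, and N is
   everything only when the signed wheel switches to -W_n. The chosen triangles are edge-disjoint.
   For each chosen i delete one edge of T_i: the spoke at i + 1 if T_{i+1} is negative too, and the
   rim edge otherwise. What remains can be switched to all positive, so the frustration index is
   at most the number of chosen triangles. *)

theory Submission
  imports Defs
begin

section \<open>Signed graphs\<close>

lemma Suc_mod_eq: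
  fixes i n :: nat
  shows "i < n \<Longrightarrow> Suc i mod n = (if Suc i = n then 0 else Suc i)"
  by auto

text \<open>Fails for \<open>n = 2\<close>, where \<open>{0, 1}\<close> and \<open>{1, 0}\<close>
  coincide. It makes the edges of a cycle, listed by position, pairwise distinct.\<close>

lemma cyclic_pair_inj:
  fixes i j n :: nat
  assumes "n \<ge> 3" "i < n" "j < n" "{i, Suc i mod n} = {j, Suc j mod n}"
  shows "i = j"
  using assms by (auto simp: Suc_mod_eq doubleton_eq_iff split: if_splits)

lemma Suc_mod_inj:
  fixes i j n :: nat
  shows "Suc i mod n = Suc j mod n \<Longrightarrow> i < n \<Longrightarrow> j < n \<Longrightarrow> i = j"
  by (auto simp: Suc_mod_eq split: if_splits)

lemma bij_betw_Suc_mod: "bij_betw (\<lambda>i. Suc i mod n) {..<n} {..<n}"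
proof -
  have "inj_on (\<lambda>i. Suc i mod n) {..<n}"
    by (rule inj_onI, rule Suc_mod_inj) simp_all
  moreover have "(\<lambda>i. Suc i mod n) ` {..<n} \<subseteq> {..<n}"
    by (rule image_subsetI) simp
  ultimately show ?thesis
    by (simp add: bij_betw_def endo_inj_surj)
qed

section \<open>Cycles, their signs and balance\<close>

lemma finite_edges: "simple_graph G \<Longrightarrow> finite (edges G)"
  unfolding simple_graph_def by (rule finite_subset[of _ "Pow (verts G)"]) auto

lemma cycles_subset: "cycles G \<subseteq> Pow (edges G)"
  by (auto simp: cycles_def)

lemma finite_cycles: "simple_graph G \<Longrightarrow> finite (cycles G)"
  using finite_subset[OF cycles_subset] finite_edges by blast

lemma cycle_edges_eq_image:
  "cycle_edges vs = (\<lambda>i. {vs ! i, vs ! (Suc i mod length vs)}) ` {..<length vs}"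
  by (auto simp: cycle_edges_def)

text \<open>Distinct positions give distinct edges, so the product over the edge set can be
  reindexed by positions in the vertex list.\<close>

lemma cycle_sign_cycle_edges:
  assumes "length vs \<ge> 3" "distinct vs"
  shows "cycle_sign \<sigma> (cycle_edges vs) = (\<Prod>i<length vs. \<sigma> {vs ! i, vs ! (Suc i mod length vs)})"
proof -
  let ?n = "length vs"
  have n: "?n > 0" using assms(1) by linarith
  have "inj_on (\<lambda>i. {vs ! i, vs ! (Suc i mod ?n)}) {..<?n}"
  proof (rule inj_onI)
    fix i j assume ij: "i \<in> {..<?n}" "j \<in> {..<?n}"
      and "{vs ! i, vs ! (Suc i mod ?n)} = {vs ! j, vs ! (Suc j mod ?n)}"
    then have "(!) vs ` {i, Suc i mod ?n} = (!) vs ` {j, Suc j mod ?n}"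
      by simp
    moreover have "inj_on ((!) vs) {..<?n}"
      using assms(2) by (simp add: inj_on_nth)
    ultimately have "{i, Suc i mod ?n} = {j, Suc j mod ?n}"
      by (rule inj_on_image_eq_iff[THEN iffD1, rotated -1]) (use ij n in auto)
    then show "i = j"
      using cyclic_pair_inj assms(1) ij by auto
  qed
  then show ?thesis
    by (simp add: cycle_sign_def cycle_edges_eq_image prod.reindex)
qed

text \<open>The easy half of Harary's criterion, with \<open>s\<close> as the switching function
  that makes every edge positive: round a cycle each vertex contributes its factor
  \<open>s v\<close> twice.\<close>

lemma balancedI_potential:
  fixes s :: "'a \<Rightarrow> int"
  assumes s: "\<And>v. s v * s v = 1"
    and \<sigma>: "\<And>u v. {u, v} \<in> edges G \<Longrightarrow> \<sigma> {u, v} = s u * s v"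
  shows "balanced G \<sigma>"
  unfolding balanced_def
proof
  fix C assume "C \<in> cycles G"
  then obtain vs where vs: "C = cycle_edges vs" "length vs \<ge> 3" "distinct vs" "cycle_edges vs \<subseteq> edges G"
    by (auto simp: cycles_def)
  let ?n = "length vs"
  have "cycle_sign \<sigma> C = (\<Prod>i<?n. \<sigma> {vs ! i, vs ! (Suc i mod ?n)})"
    using vs by (simp add: cycle_sign_cycle_edges)
  also have "\<dots> = (\<Prod>i<?n. s (vs ! i) * s (vs ! (Suc i mod ?n)))"
    by (rule prod.cong) (use vs(4) in \<open>auto simp: cycle_edges_def intro!: \<sigma>\<close>)
  also have "\<dots> = (\<Prod>i<?n. s (vs ! i)) * (\<Prod>i<?n. s (vs ! (Suc i mod ?n)))"
    by (rule prod.distrib)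
  also have "(\<Prod>i<?n. s (vs ! (Suc i mod ?n))) = (\<Prod>i<?n. s (vs ! i))"
    by (rule prod.reindex_bij_betw[OF bij_betw_Suc_mod])
  also have "(\<Prod>i<?n. s (vs ! i)) * (\<Prod>i<?n. s (vs ! i)) = 1"
    by (simp flip: prod.distrib add: s)
  finally show "cycle_sign \<sigma> C = 1" .
qed

section \<open>Weak duality between packings and deletion sets\<close>

lemma frustration_index_le:
  assumes "simple_graph G" "F \<subseteq> edges G" "balanced (delete_edges G F) \<sigma>"
  shows "frustration_index G \<sigma> \<le> card F"
  unfolding frustration_index_def
proof (rule Min_le)
  show "finite {card F |F. F \<subseteq> edges G \<and> balanced (delete_edges G F) \<sigma>}"
    using finite_edges[OF assms(1)] by (auto intro: finite_subset[of _ "card ` Pow (edges G)"])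
qed (use assms in auto)

lemma finite_packings:
  assumes "simple_graph G" "A \<subseteq> cycles G"
  shows "finite {card P |P. P \<subseteq> A \<and> pairwise disjnt P}"
proof (rule finite_subset)
  show "{card P |P. P \<subseteq> A \<and> pairwise disjnt P} \<subseteq> card ` Pow A" by auto
  show "finite (card ` Pow A)"
    using finite_subset[OF assms(2) finite_cycles[OF assms(1)]] by simp
qed

lemma neg_triangle_packing_ge:
  assumes "simple_graph G" "P \<subseteq> {C \<in> triangles G. cycle_sign \<sigma> C = -1}" "pairwise disjnt P"
  shows "card P \<le> neg_triangle_packing G \<sigma>"
  unfolding neg_triangle_packing_def
  by (rule Max_ge[OF finite_packings]) (use assms in \<open>auto simp: triangles_def\<close>)

lemma neg_triangle_packing_le_neg_cycle_packing:
  assumes "simple_graph G"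
  shows "neg_triangle_packing G \<sigma> \<le> neg_cycle_packing G \<sigma>"
  unfolding neg_triangle_packing_def neg_cycle_packing_def
proof (rule Max_mono)
  show "{card P |P. P \<subseteq> {C \<in> triangles G. cycle_sign \<sigma> C = -1} \<and> pairwise disjnt P}
      \<subseteq> {card P |P. P \<subseteq> {C \<in> cycles G. cycle_sign \<sigma> C = -1} \<and> pairwise disjnt P}"
    by (auto simp: triangles_def)
  show "{card P |P. P \<subseteq> {C \<in> triangles G. cycle_sign \<sigma> C = -1} \<and> pairwise disjnt P} \<noteq> {}"
    unfolding Collect_empty_eq by (metis empty_subsetI pairwise_empty)
  show "finite {card P |P. P \<subseteq> {C \<in> cycles G. cycle_sign \<sigma> C = -1} \<and> pairwise disjnt P}"
    by (rule finite_packings[OF assms]) auto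
qed

text \<open>A negative cycle avoiding \<open>F\<close> would survive the deletion, so each member of
  \<open>P\<close> contains an edge of \<open>F\<close>; disjointness makes the choice of such edges
  injective.\<close>

lemma card_packing_le_card_deletion:
  assumes G: "simple_graph G"
    and F: "F \<subseteq> edges G" "balanced (delete_edges G F) \<sigma>"
    and P: "P \<subseteq> {C \<in> cycles G. cycle_sign \<sigma> C = -1}" "pairwise disjnt P"
  shows "card P \<le> card F"
proof -
  have "C \<inter> F \<noteq> {}" if "C \<in> P" for C
  proof
    assume "C \<inter> F = {}"
    moreover have "C \<in> cycles G" "cycle_sign \<sigma> C = -1" using that P by auto
    ultimately have "C \<in> cycles (delete_edges G F)"
      by (fastforce simp: cycles_def delete_edges_def)
    with F(2) \<open>cycle_sign \<sigma> C = -1\<close> show False by (auto simp: balanced_def)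
  qed
  then have "\<forall>C\<in>P. \<exists>e. e \<in> C \<inter> F" by blast
  then obtain f where f: "\<And>C. C \<in> P \<Longrightarrow> f C \<in> C \<inter> F" by metis
  have "inj_on f P"
  proof (rule inj_onI, rule ccontr)
    fix C C' assume CC': "C \<in> P" "C' \<in> P" "f C = f C'" "C \<noteq> C'"
    then have "f C \<in> C \<inter> C'" using f by fastforce
    moreover have "disjnt C C'" using P(2) CC' by (simp add: pairwise_def)
    ultimately show False by (auto simp: disjnt_def)
  qed
  then show ?thesis
    using f finite_subset[OF F(1) finite_edges[OF G]] by (intro card_inj_on_le[of f]) auto
qed

lemma neg_cycle_packing_le_frustration_index:
  assumes "simple_graph G"
  shows "neg_cycle_packing G \<sigma> \<le> frustration_index G \<sigma>"
proof -
  let ?A = "{card P |P. P \<subseteq> {C \<in> cycles G. cycle_sign \<sigma> C = -1} \<and> pairwise disjnt P}"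
  let ?B = "{card F |F. F \<subseteq> edges G \<and> balanced (delete_edges G F) \<sigma>}"
  have "Max ?A \<in> ?A"
  proof (rule Max_in)
    show "finite ?A" by (rule finite_packings[OF assms]) auto
    have "card {} \<in> ?A" by (intro CollectI exI[of _ "{}"]) simp
    then show "?A \<noteq> {}" by blast
  qed
  moreover have "Min ?B \<in> ?B"
  proof (rule Min_in)
    show "finite ?B"
      using finite_edges[OF assms] by (auto intro: finite_subset[of _ "card ` Pow (edges G)"])
    \<comment> \<open>Deleting every edge is always admissible, so the minimum is taken over a
      nonempty set.\<close>
    have "balanced (delete_edges G (edges G)) \<sigma>"
      by (rule balancedI_potential[where s = "\<lambda>_. 1"]) (auto simp: delete_edges_def)
    then show "?B \<noteq> {}" by auto
  qed
  ultimately show ?thesis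
    unfolding neg_cycle_packing_def frustration_index_def
    using card_packing_le_card_deletion[OF assms] by auto
qed

section \<open>Greedy choice around a cycle\<close>

text \<open>The recursion runs along all natural numbers without closing up; a cycle is treated by
  unrolling it into a periodic \<open>Q\<close>.\<close>

fun greedy :: "(nat \<Rightarrow> bool) \<Rightarrow> nat \<Rightarrow> bool" where
  "greedy Q 0 = Q 0"
| "greedy Q (Suc k) = (Q (Suc k) \<and> \<not> greedy Q k)"

text \<open>If \<open>N\<close> holds everywhere, the recursion forces alternation, which closes up
  for even \<open>n\<close>. An index where \<open>N\<close> fails resets the recursion and so
  breaks the cyclic dependency.\<close>

lemma ex_cyclic_greedy:
  assumes "\<not> (\<forall>i<n. N i) \<or> even n"
  shows "\<exists>g. \<forall>i<n. g (Suc i mod n) \<longleftrightarrow> N (Suc i mod n) \<and> \<not> g i"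
proof (cases "\<forall>i<n. N i")
  case True
  with assms have "even n" by blast
  then have "even (Suc i mod n) \<longleftrightarrow> \<not> even i" for i
    by (simp add: dvd_mod_iff)
  with True show ?thesis
    by (intro exI[of _ even]) auto
next
  case False
  then obtain m where m: "m < n" "\<not> N m" by blast
  define h where "h = greedy (\<lambda>k. N (k mod n))"
  have h_Suc: "h (Suc k) \<longleftrightarrow> N (Suc k mod n) \<and> \<not> h k" for k
    by (simp add: h_def)
  \<comment> \<open>The greedy choice starts afresh at \<open>m\<close>, hence is periodic from there on.\<close>
  have h_False: "\<not> h k" if "k mod n = m" for k
    using m that by (cases k) (auto simp: h_def)
  have period: "h (m + k) = h (m + n + k)" for k
  proof (induction k)
    case 0
    then show ?case using m h_False[of m] h_False[of "m + n"] by simp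
  next
    case (Suc k)
    have "Suc (m + n + k) mod n = Suc (m + k) mod n"
      by (metis add.assoc add.commute add_Suc mod_add_self2)
    then show ?case using Suc by (simp add: h_Suc)
  qed
  show ?thesis
  \<comment> \<open>Periodicity is known only from \<open>m\<close> on, and \<open>m < n\<close>;
    the shift by \<open>n\<close> reads off the second turn, which lies in the periodic
    range.\<close>
  proof (intro exI[of _ "\<lambda>i. h (i + n)"] allI impI)
    fix i assume i: "i < n"
    have "h (Suc i mod n + n) = h (Suc (i + n))"
    proof (cases "Suc i = n")
      case True
      then show ?thesis using period[of "n - m"] m by (simp add: flip: add_Suc)
    next
      case False
      then show ?thesis using i by simp
    qed
    moreover have "Suc (i + n) mod n = Suc i mod n"
      by (metis add_Suc mod_add_self2)
    ultimately show "h (Suc i mod n + n) \<longleftrightarrow> N (Suc i mod n) \<and> \<not> h (i + n)"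
      by (simp add: h_Suc)
  qed
qed

section \<open>Wheels\<close>

lemma verts_wheel: "verts (wheel n) = {..n}"
  by (auto simp: wheel_def graph_join_def complete_graph_def cycle_graph_def)

lemma edges_wheel: "edges (wheel n) = {{n, i} |i. i < n} \<union> {{i, Suc i mod n} |i. i < n}"
  by (auto simp: wheel_def graph_join_def complete_graph_def cycle_graph_def)

lemma spoke_in_edges: "i < n \<Longrightarrow> {n, i} \<in> edges (wheel n)"
  unfolding edges_wheel by blast

lemma rim_in_edges: "i < n \<Longrightarrow> {i, Suc i mod n} \<in> edges (wheel n)"
  unfolding edges_wheel by blast

section \<open>Triangles through the hub\<close>

definition hub_triangle :: "nat \<Rightarrow> nat \<Rightarrow> nat set set" where
  "hub_triangle n i = {{n, i}, {i, Suc i mod n}, {n, Suc i mod n}}"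

lemma hub_triangle_eq_cycle_edges: "hub_triangle n i = cycle_edges [n, i, Suc i mod n]"
  by (auto simp: hub_triangle_def cycle_edges_eq_image lessThan_Suc insert_commute)

lemma Suc_mod_neq:
  fixes i n :: nat
  assumes "n \<ge> 3" "i < n"
  shows "Suc i mod n \<noteq> i" "Suc i mod n < n"
  using assms by (auto simp: Suc_mod_eq)

lemma hub_triangle_in_triangles:
  assumes "n \<ge> 3" "i < n"
  shows "hub_triangle n i \<in> triangles (wheel n)"
proof -
  define j where "j = Suc i mod n"
  have j: "j \<noteq> i" "j < n" using Suc_mod_neq[OF assms] by (simp_all add: j_def)
  have tri: "hub_triangle n i = {{n, i}, {i, j}, {n, j}}"
    by (simp add: hub_triangle_def j_def)
  have "hub_triangle n i \<subseteq> edges (wheel n)"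
    using assms(2) j(2) by (simp add: tri spoke_in_edges) (simp add: j_def rim_in_edges)
  moreover have "hub_triangle n i = cycle_edges [n, i, j]"
    unfolding j_def by (rule hub_triangle_eq_cycle_edges)
  moreover have "length [n, i, j] \<ge> 3" "distinct [n, i, j]" "set [n, i, j] \<subseteq> verts (wheel n)"
    using assms(2) j by (auto simp: verts_wheel)
  ultimately have "hub_triangle n i \<in> cycles (wheel n)"
    unfolding cycles_def by blast
  moreover have "card (hub_triangle n i) = 3"
    using assms(2) j by (auto simp: tri doubleton_eq_iff card_insert_if)
  ultimately show ?thesis by (simp add: triangles_def)
qed

lemma cycle_sign_hub_triangle:
  assumes "n \<ge> 3" "i < n"
  shows "cycle_sign \<sigma> (hub_triangle n i) = \<sigma> {n, i} * \<sigma> {i, Suc i mod n} * \<sigma> {n, Suc i mod n}"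
proof -
  define j where "j = Suc i mod n"
  have "j \<noteq> i" "j < n" using Suc_mod_neq[OF assms] by (simp_all add: j_def)
  then have "{n, i} \<noteq> {i, j}" "{n, i} \<noteq> {n, j}" "{i, j} \<noteq> {n, j}"
    using assms(2) by (auto simp: doubleton_eq_iff)
  then show ?thesis
    unfolding cycle_sign_def hub_triangle_def j_def[symmetric] by simp
qed

text \<open>Two different hub triangles can share only a spoke, whose rim end then lies on both rim
  edges; this happens only for cyclic neighbours.\<close>

lemma disjnt_hub_triangles:
  assumes "n \<ge> 3" "i < n" "j < n" "i \<noteq> j" "Suc i mod n \<noteq> j" "Suc j mod n \<noteq> i"
  shows "disjnt (hub_triangle n i) (hub_triangle n j)"
proof -
  define i' j' where "i' = Suc i mod n" and "j' = Suc j mod n"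
  have "i \<noteq> n" "j \<noteq> n" "i' \<noteq> n" "j' \<noteq> n"
    using Suc_mod_neq(2)[OF assms(1)] assms(2,3) unfolding i'_def j'_def by (metis less_irrefl)+
  moreover have "i' \<noteq> j'"
    using Suc_mod_inj assms(2-4) unfolding i'_def j'_def by blast
  moreover have "i' \<noteq> j" "j' \<noteq> i" using assms(5,6) by (simp_all add: i'_def j'_def)
  ultimately show ?thesis
    using assms(4) unfolding hub_triangle_def i'_def[symmetric] j'_def[symmetric]
    by (simp add: doubleton_eq_iff)
qed

text \<open>Switching at the rim ends of the positive spokes makes all spokes negative. Triangle
  signs are unchanged by switching, so every rim edge becomes negative too.\<close>

lemma switching_equivalent_all_negative:
  assumes n: "n \<ge> 3" and \<sigma>: "signature (wheel n) \<sigma>"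
    and neg: "\<And>i. i < n \<Longrightarrow> cycle_sign \<sigma> (hub_triangle n i) = -1"
  shows "switching_equivalent (wheel n) \<sigma> all_negative"
proof -
  define X where "X = {i. i < n \<and> \<sigma> {n, i} = 1}"
  have spoke: "\<sigma> {n, i} = 1 \<or> \<sigma> {n, i} = -1" if "i < n" for i
    using \<sigma> spoke_in_edges[OF that] by (simp add: signature_def)
  have "all_negative e = switch X \<sigma> e" if "e \<in> edges (wheel n)" for e
  proof -
    from that consider i where "i < n" "e = {n, i}" | i where "i < n" "e = {i, Suc i mod n}"
      unfolding edges_wheel by blast
    then show ?thesis
    proof cases
      case 1
      then have "e \<inter> X = (if \<sigma> e = 1 then {i} else {})" by (auto simp: X_def)
      then show ?thesis
        using spoke[OF 1(1)] unfolding 1(2) all_negative_def switch_def by (auto split: if_splits)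
    next
      case 2
      define j where "j = Suc i mod n"
      have j: "j \<noteq> i" "j < n" using Suc_mod_neq[OF n 2(1)] by (simp_all add: j_def)
      have "e \<inter> X = (if \<sigma> {n, i} = 1 then {i} else {}) \<union> (if \<sigma> {n, j} = 1 then {j} else {})"
        using 2(1) j(2) unfolding 2(2) j_def[symmetric] X_def by auto
      then have "card (e \<inter> X) = (if \<sigma> {n, i} = 1 then 1 else 0) + (if \<sigma> {n, j} = 1 then 1 else 0)"
        using j(1) by simp
      moreover have "\<sigma> {n, i} * \<sigma> e * \<sigma> {n, j} = -1"
        using neg[OF 2(1)] cycle_sign_hub_triangle[OF n 2(1), of \<sigma>] by (simp add: j_def 2(2))
      ultimately show ?thesis
        using spoke[OF 2(1)] spoke[OF j(2)] unfolding all_negative_def switch_def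
        by (elim disjE) simp_all
    qed
  qed
  moreover have "X \<subseteq> verts (wheel n)" by (auto simp: X_def verts_wheel)
  ultimately show ?thesis unfolding switching_equivalent_def by blast
qed

text \<open>Works for any greedy choice \<open>g\<close> that closes up round the rim; the parity
  and switching hypotheses serve only to provide one.\<close>

lemma wheel_frustration_index_le_neg_triangle_packing:
  assumes n: "n \<ge> 3" and \<sigma>: "signature (wheel n) \<sigma>"
    and N_def: "\<And>i. N i \<longleftrightarrow> cycle_sign \<sigma> (hub_triangle n i) = -1"
    and greedy: "\<And>i. i < n \<Longrightarrow> g (Suc i mod n) \<longleftrightarrow> N (Suc i mod n) \<and> \<not> g i"
  shows "frustration_index (wheel n) \<sigma> \<le> neg_triangle_packing (wheel n) \<sigma>"
proof -
  define nx where "nx i = Suc i mod n" for i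
  have nx: "nx i < n" "nx i \<noteq> i" if "i < n" for i
    using Suc_mod_neq[OF n that] by (simp_all add: nx_def)
  have g_nx: "g (nx i) \<longleftrightarrow> N (nx i) \<and> \<not> g i" if "i < n" for i
    using greedy[OF that] by (simp add: nx_def)
  \<comment> \<open>\<open>I\<close> indexes the chosen triangles and \<open>D\<close> the negative
    ones passed over. The predecessor of an index in \<open>D\<close> was chosen, so the spoke at
    that index lies in both triangles. \<open>B\<close> holds the chosen indices whose successor
    triangle is not negative.\<close>
  define I where "I = {i. i < n \<and> g i}"
  define D where "D = {i. i < n \<and> N i \<and> \<not> g i}"
  define B where "B = {i. i < n \<and> g i \<and> \<not> N (nx i)}"
  define F where "F = (\<lambda>i. {n, i}) ` D \<union> (\<lambda>i. {i, nx i}) ` B"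
  have onto: "\<exists>j<n. i = nx j" if "i < n" for i
  proof -
    have "i \<in> nx ` {..<n}"
      using bij_betw_imp_surj_on[OF bij_betw_Suc_mod, of n] that by (simp add: nx_def)
    then show ?thesis by auto
  qed
  have gN: "N i" if "i < n" "g i" for i
    using onto[OF that(1)] that(2) g_nx by blast
  have fin: "finite I" by (simp add: I_def)

  have F_le: "card F \<le> card I"
  proof -
    \<comment> \<open>Each deleted spoke is charged to the chosen predecessor and each deleted rim
      edge to its own index in \<open>B\<close>; no chosen index is charged twice.\<close>
    have "D \<subseteq> nx ` {i \<in> I. N (nx i)}"
    proof
      fix i assume "i \<in> D"
      then have i: "i < n" "N i" "\<not> g i" by (simp_all add: D_def)
      then obtain j where j: "j < n" "i = nx j" using onto by blast
      with i g_nx[OF j(1)] show "i \<in> nx ` {i \<in> I. N (nx i)}"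
        by (intro image_eqI[of _ _ j]) (simp_all add: I_def)
    qed
    then have "card D \<le> card {i \<in> I. N (nx i)}"
      using fin by (intro surj_card_le) auto
    moreover have "card I = card {i \<in> I. N (nx i)} + card B"
    proof -
      have "I = {i \<in> I. N (nx i)} \<union> B" "{i \<in> I. N (nx i)} \<inter> B = {}"
        by (auto simp: I_def B_def)
      moreover have "finite {i \<in> I. N (nx i)}" "finite B"
        using fin by (simp_all add: B_def)
      ultimately show ?thesis using card_Un_disjoint by metis
    qed
    moreover have "card F \<le> card D + card B"
      unfolding F_def
      by (rule order_trans[OF card_Un_le add_mono])
        (auto intro: card_image_le simp: D_def B_def)
    ultimately show ?thesis by simp
  qed

  have disj: "disjnt (hub_triangle n i) (hub_triangle n j)" if "i \<in> I" "j \<in> I" "i \<noteq> j" for i j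
  proof (rule disjnt_hub_triangles[OF n])
    show "i < n" "j < n" "i \<noteq> j" using that by (simp_all add: I_def)
    then show "Suc i mod n \<noteq> j" "Suc j mod n \<noteq> i"
      using that greedy unfolding I_def by blast+
  qed
  have "card (hub_triangle n ` I) \<le> neg_triangle_packing (wheel n) \<sigma>"
  proof (rule neg_triangle_packing_ge)
    show "simple_graph (wheel n)" using n by (rule simple_graph_wheel)
    show "hub_triangle n ` I \<subseteq> {C \<in> triangles (wheel n). cycle_sign \<sigma> C = -1}"
      using gN N_def hub_triangle_in_triangles[OF n] by (auto simp: I_def)
  next
    show "pairwise disjnt (hub_triangle n ` I)"
      using disj unfolding pairwise_def by blast
  qed
  \<comment> \<open>Disjointness for distinct indices gives injectivity because the triangles are
    nonempty.\<close>
  moreover have "inj_on (hub_triangle n) I"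
  proof (rule inj_onI, rule ccontr)
    fix i j assume "i \<in> I" "j \<in> I" "hub_triangle n i = hub_triangle n j" "i \<noteq> j"
    then have "disjnt (hub_triangle n i) (hub_triangle n i)"
      using disj[of i j] by simp
    then show False by (simp add: disjnt_def hub_triangle_def)
  qed
  ultimately have I_le: "card I \<le> neg_triangle_packing (wheel n) \<sigma>"
    by (simp add: card_image)

  have spoke: "\<sigma> {n, i} = 1 \<or> \<sigma> {n, i} = -1" and rim: "\<sigma> {i, nx i} = 1 \<or> \<sigma> {i, nx i} = -1"
    if "i < n" for i
    using \<sigma> spoke_in_edges[OF that] rim_in_edges[OF that] by (simp_all add: signature_def nx_def)
  \<comment> \<open>With value 1 at the hub, a kept spoke determines \<open>s\<close> at its rim
    end. At \<open>D\<close> the spoke is deleted, so the value is free and is flipped to repair the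
    adjacent rim edges.\<close>
  define s where "s v = (if v < n then if v \<in> D then - \<sigma> {n, v} else \<sigma> {n, v} else 1)" for v
  have spoke_s: "\<sigma> {n, i} = s n * s i" if "i < n" "{n, i} \<notin> F" for i
    using that by (auto simp: s_def F_def)
  have rim_s: "\<sigma> {i, nx i} = s i * s (nx i)" if i: "i < n" and iF: "{i, nx i} \<notin> F" for i
  proof -
    have "i \<notin> B" using iF by (auto simp: F_def)
    \<comment> \<open>If \<open>i\<close> is chosen, \<open>i \<notin> B\<close> puts
      \<open>nx i\<close> in \<open>D\<close>; if \<open>i\<close> is not chosen,
      \<open>nx i\<close> is chosen whenever it is negative, hence never in \<open>D\<close>. So
      exactly the negative triangles with a kept rim edge see one flip.\<close>
    then have "N i \<longleftrightarrow> (i \<in> D) \<noteq> (nx i \<in> D)"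
      using i nx[OF i] g_nx[OF i] gN[OF i] by (auto simp: B_def D_def)
    moreover have "N i \<longleftrightarrow> \<sigma> {n, i} * \<sigma> {i, nx i} * \<sigma> {n, nx i} = -1"
      by (simp add: N_def cycle_sign_hub_triangle n i nx_def)
    ultimately show ?thesis
      using spoke[OF i] spoke[OF nx(1)[OF i]] rim[OF i] i nx(1)[OF i] by (auto simp: s_def)
  qed
  have "balanced (delete_edges (wheel n) F) \<sigma>"
  proof (rule balancedI_potential)
    show "s v * s v = 1" for v using spoke[of v] by (auto simp: s_def)
    fix u v assume "{u, v} \<in> edges (delete_edges (wheel n) F)"
    then have uv: "{u, v} \<in> edges (wheel n)" "{u, v} \<notin> F" by (auto simp: delete_edges_def)
    then consider i where "i < n" "{u, v} = {n, i}" | i where "i < n" "{u, v} = {i, nx i}"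
      unfolding edges_wheel nx_def by blast
    then show "\<sigma> {u, v} = s u * s v"
    proof cases
      case 1
      then have "\<sigma> {u, v} = s n * s i" using spoke_s uv(2) by simp
      also have "\<dots> = s u * s v" using 1(2) unfolding doubleton_eq_iff by auto
      finally show ?thesis .
    next
      case 2
      then have "\<sigma> {u, v} = s i * s (nx i)" using rim_s uv(2) by simp
      also have "\<dots> = s u * s v" using 2(2) unfolding doubleton_eq_iff by auto
      finally show ?thesis .
    qed
  qed
  moreover have "F \<subseteq> edges (wheel n)" unfolding F_def D_def B_def edges_wheel nx_def by blast
  ultimately have "frustration_index (wheel n) \<sigma> \<le> card F"
    using simple_graph_wheel[OF n] by (intro frustration_index_le)
  with F_le I_le show ?thesis by linarith
qed

theorem theorem24:
  fixes n :: nat and \<sigma> :: "nat set \<Rightarrow> int"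
  assumes "n \<ge> 3"
    and "signature (wheel n) \<sigma>"
    and "even n \<or> (odd n \<and> \<not> switching_equivalent (wheel n) \<sigma> all_negative)"
  shows "frustration_index (wheel n) \<sigma> = neg_cycle_packing (wheel n) \<sigma> \<and>
         neg_cycle_packing (wheel n) \<sigma> = neg_triangle_packing (wheel n) \<sigma>"
proof -
  let ?N = "\<lambda>i. cycle_sign \<sigma> (hub_triangle n i) = -1"
  \<comment> \<open>For odd \<open>n\<close>, negativity of all hub triangles would give the
    excluded switching equivalence.\<close>
  have "\<not> (\<forall>i<n. ?N i) \<or> even n"
    using assms switching_equivalent_all_negative by blast
  then obtain g where "\<forall>i<n. g (Suc i mod n) \<longleftrightarrow> ?N (Suc i mod n) \<and> \<not> g i"
    using ex_cyclic_greedy[of n ?N] by blast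
  then have "frustration_index (wheel n) \<sigma> \<le> neg_triangle_packing (wheel n) \<sigma>"
    using wheel_frustration_index_le_neg_triangle_packing[OF assms(1,2), of ?N g] by blast
  \<comment> \<open>These two bounds close the cycle of inequalities, forcing all three numbers to
    agree.\<close>
  moreover note neg_triangle_packing_le_neg_cycle_packing neg_cycle_packing_le_frustration_index
  ultimately show ?thesis
    using simple_graph_wheel[OF assms(1)] by (metis order_antisym order_trans)
qed

end
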